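(* Let $(G,X,\Gamma)$ be a $(\mu,\nu)$-path system group. Assume that $G$ contains a constricting element. Let $H$ be an infinite index quasi-convex subgroup of $G$. Then $\omega_{G/H}=\omega_{H\backslash G}=\omega_G$.
   Context: A path in a metric space $X$ is a rectifiable continuous map $\alpha\colon[a,b]\to X$ parametrised by arc length; it is a $(\kappa,\lambda)$-quasi-geodesic if $d(\alpha(t),\alpha(t'))\le |t-t'|\le \kappa\, d(\alpha(t),\alpha(t'))+\lambda$ for all $t,t'$. $Y^{+\eta}=\{x: d(x,Y)\le\eta\}$. A $(\mu,\nu)$-path system on a geodesic metric space $X$ is a collection $\Gamma$ of paths closed under subpaths, such that any two points are joined by an element of $\Gamma$ and every element of $\Gamma$ is a $(\mu,\nu)$-quasi-geodesic. A $(\mu,\nu)$-path system group $(G,X,\Gamma)$ is a group $G$ acting properly by isometries on a geodesic metric space $X$ (balls $B_G(x,r)=\{g\in G: d(x,gx)\le r\}$ finite) with $\Gamma$ a $G$-invariant $(\mu,\nu)$-path system. A subset $Y$ is $\eta$-quasi-convex if every $\gamma\in\Gamma$ with endpoints in $Y$ lies in $Y^{+\eta}$. A subgroup $H$ is quasi-convex if for some $\eta\ge0$ there is an $H$-invariant $\eta$-quasi-convex $Y\subseteq X$ on which $H$ acts $\eta$-coboundedly (for all $y,y'\in Y$ there is $h\in H$ with $d(y,hy')\le\eta$). A subset $A$ is $\delta$-constricting if there is $\pi_A\colon X\to A$ with (CS1) $d(x,\pi_A(x))\le\delta$ for $x\in A$, and (CS2) for all $x,y\in X$ and $\gamma\in\Gamma$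 joining them, if $d(\pi_A(x),\pi_A(y))>\delta$ then $\gamma$ meets $B_X(\pi_A(x),\delta)$ and $B_X(\pi_A(y),\delta)$. An element $g$ is constricting if it has infinite order and for some $\delta$ there is a $\langle g\rangle$-invariant $\delta$-constricting $A$ on which $\langle g\rangle$ acts $\delta$-coboundedly. For $o\in X$: $\omega_G=\limsup_{r\to\infty}\frac1r\log|B_G(o,r)|$, $\omega_{G/H}=\limsup_{r\to\infty}\frac1r\log|\mathcal L(B_G(o,r))|$ and $\omega_{H\backslash G}=\limsup_{r\to\infty}\frac1r\log|\mathcal R(B_G(o,r))|$, where $\mathcal L\colon G\to G/H$ and $\mathcal R\colon G\to H\backslash G$ are the natural maps to left and right cosets. *)

theory Defs
  imports "HOL-Analysis.Analysis" "HOL-Algebra.Coset" "HOL-Algebra.Generated_Groups"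
begin

definition geodesic_space :: "'x::metric_space itself \<Rightarrow> bool" where
  "geodesic_space _ \<longleftrightarrow> (\<forall>x y::'x. \<exists>c::real \<Rightarrow> 'x. c 0 = x \<and> c (dist x y) = y \<and>
     (\<forall>s\<in>{0..dist x y}. \<forall>t\<in>{0..dist x y}. dist (c s) (c t) = \<bar>s - t\<bar>))"

fun chain_len :: "(real \<Rightarrow> 'x::metric_space) \<Rightarrow> real list \<Rightarrow> real" where
  "chain_len \<alpha> (u # v # ps) = dist (\<alpha> u) (\<alpha> v) + chain_len \<alpha> (v # ps)"
| "chain_len \<alpha> _ = 0"

definition curve_length :: "(real \<Rightarrow> 'x::metric_space) \<Rightarrow> real \<Rightarrow> real \<Rightarrow> ereal" where
  "curve_length \<alpha> s t = (SUP ps \<in> {ps. sorted ps \<and> ps \<noteq> [] \<and> hd ps = s \<and> last ps = t}.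
                           ereal (chain_len \<alpha> ps))"

text \<open>A path is encoded as a triple (a, b, alpha) standing for alpha restricted to [a,b].\<close>
type_synonym 'x path = "real \<times> real \<times> (real \<Rightarrow> 'x)"

definition is_path :: "'x::metric_space path \<Rightarrow> bool" where
  "is_path p \<longleftrightarrow> (case p of (a, b, \<alpha>) \<Rightarrow> a \<le> b \<and> continuous_on {a..b} \<alpha> \<and>
      (\<forall>s t. a \<le> s \<and> s \<le> t \<and> t \<le> b \<longrightarrow> curve_length \<alpha> s t = ereal (t - s)))"

definition quasi_geodesic :: "real \<Rightarrow> real \<Rightarrow> 'x::metric_space path \<Rightarrow> bool" where
  "quasi_geodesic k l p \<longleftrightarrow> is_path p \<and> (case p of (a, b, \<alpha>) \<Rightarrow>
      (\<forall>t\<in>{a..b}. \<forall>t'\<in>{a..b}. dist (\<alpha> t) (\<alpha> t') \<le> \<bar>t - t'\<bar> \<and>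
                                \<bar>t - t'\<bar> \<le> k * dist (\<alpha> t) (\<alpha> t') + l))"

definition path_image' :: "'x path \<Rightarrow> 'x set" where
  "path_image' p = (case p of (a, b, \<alpha>) \<Rightarrow> \<alpha> ` {a..b})"

definition start_pt :: "'x path \<Rightarrow> 'x" where
  "start_pt p = (case p of (a, b, \<alpha>) \<Rightarrow> \<alpha> a)"

definition end_pt :: "'x path \<Rightarrow> 'x" where
  "end_pt p = (case p of (a, b, \<alpha>) \<Rightarrow> \<alpha> b)"

definition nbhd :: "'x::metric_space set \<Rightarrow> real \<Rightarrow> 'x set" where
  "nbhd Y \<eta> = {x. infdist x Y \<le> \<eta>}"

definition path_system :: "real \<Rightarrow> real \<Rightarrow> 'x::metric_space path set \<Rightarrow> bool" where
  "path_system \<mu> \<nu> \<Gamma> \<longleftrightarrow>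
     (\<forall>p\<in>\<Gamma>. is_path p) \<and>
     (\<forall>a b \<alpha> a' b'. (a, b, \<alpha>) \<in> \<Gamma> \<and> a \<le> a' \<and> a' \<le> b' \<and> b' \<le> b \<longrightarrow> (a', b', \<alpha>) \<in> \<Gamma>) \<and>
     (\<forall>x y. \<exists>p\<in>\<Gamma>. start_pt p = x \<and> end_pt p = y) \<and>
     (\<forall>p\<in>\<Gamma>. quasi_geodesic \<mu> \<nu> p)"

definition isometric_action :: "('g, 'b) monoid_scheme \<Rightarrow> ('g \<Rightarrow> 'x::metric_space \<Rightarrow> 'x) \<Rightarrow> bool" where
  "isometric_action G \<phi> \<longleftrightarrow> group G \<and>
     (\<forall>x. \<phi> \<one>\<^bsub>G\<^esub> x = x) \<and>
     (\<forall>g\<in>carrier G. \<forall>h\<in>carrier G. \<forall>x. \<phi> (g \<otimes>\<^bsub>G\<^esub> h) x = \<phi> g (\<phi> h x)) \<and>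
     (\<forall>g\<in>carrier G. \<forall>x y. dist (\<phi> g x) (\<phi> g y) = dist x y)"

definition gball :: "('g, 'b) monoid_scheme \<Rightarrow> ('g \<Rightarrow> 'x::metric_space \<Rightarrow> 'x) \<Rightarrow> 'x \<Rightarrow> real \<Rightarrow> 'g set" where
  "gball G \<phi> x r = {g \<in> carrier G. dist x (\<phi> g x) \<le> r}"

definition proper_action :: "('g, 'b) monoid_scheme \<Rightarrow> ('g \<Rightarrow> 'x::metric_space \<Rightarrow> 'x) \<Rightarrow> bool" where
  "proper_action G \<phi> \<longleftrightarrow> (\<forall>x r. finite (gball G \<phi> x r))"

definition path_system_group ::
  "('g, 'b) monoid_scheme \<Rightarrow> ('g \<Rightarrow> 'x::metric_space \<Rightarrow> 'x) \<Rightarrow> 'x path set \<Rightarrow> real \<Rightarrow> real \<Rightarrow> bool" where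
  "path_system_group G \<phi> \<Gamma> \<mu> \<nu> \<longleftrightarrow>
     geodesic_space TYPE('x) \<and> isometric_action G \<phi> \<and> proper_action G \<phi> \<and>
     path_system \<mu> \<nu> \<Gamma> \<and>
     (\<forall>g\<in>carrier G. \<forall>a b \<alpha>. (a, b, \<alpha>) \<in> \<Gamma> \<longrightarrow> (a, b, \<phi> g \<circ> \<alpha>) \<in> \<Gamma>)"

definition invariant_set :: "'g set \<Rightarrow> ('g \<Rightarrow> 'x \<Rightarrow> 'x) \<Rightarrow> 'x set \<Rightarrow> bool" where
  "invariant_set H \<phi> Y \<longleftrightarrow> (\<forall>h\<in>H. \<phi> h ` Y \<subseteq> Y)"

definition acts_coboundedly :: "'g set \<Rightarrow> ('g \<Rightarrow> 'x::metric_space \<Rightarrow> 'x) \<Rightarrow> 'x set \<Rightarrow> real \<Rightarrow> bool" where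
  "acts_coboundedly H \<phi> Y \<eta> \<longleftrightarrow> (\<forall>y\<in>Y. \<forall>y'\<in>Y. \<exists>h\<in>H. dist y (\<phi> h y') \<le> \<eta>)"

definition quasi_convex_set :: "'x::metric_space path set \<Rightarrow> real \<Rightarrow> 'x set \<Rightarrow> bool" where
  "quasi_convex_set \<Gamma> \<eta> Y \<longleftrightarrow>
     (\<forall>p\<in>\<Gamma>. start_pt p \<in> Y \<and> end_pt p \<in> Y \<longrightarrow> path_image' p \<subseteq> nbhd Y \<eta>)"

definition quasi_convex_subgroup ::
  "('g, 'b) monoid_scheme \<Rightarrow> ('g \<Rightarrow> 'x::metric_space \<Rightarrow> 'x) \<Rightarrow> 'x path set \<Rightarrow> 'g set \<Rightarrow> bool" where
  "quasi_convex_subgroup G \<phi> \<Gamma> H \<longleftrightarrow> subgroup H G \<and>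
     (\<exists>\<eta>\<ge>0. \<exists>Y. Y \<noteq> {} \<and> invariant_set H \<phi> Y \<and> quasi_convex_set \<Gamma> \<eta> Y \<and>
                  acts_coboundedly H \<phi> Y \<eta>)"

definition constricting_set :: "'x::metric_space path set \<Rightarrow> real \<Rightarrow> 'x set \<Rightarrow> bool" where
  "constricting_set \<Gamma> \<delta> A \<longleftrightarrow> (\<exists>\<pi>. (\<forall>x. \<pi> x \<in> A) \<and>
     (\<forall>x\<in>A. dist x (\<pi> x) \<le> \<delta>) \<and>
     (\<forall>x y. \<forall>p\<in>\<Gamma>. start_pt p = x \<and> end_pt p = y \<and> dist (\<pi> x) (\<pi> y) > \<delta> \<longrightarrow>
         path_image' p \<inter> cball (\<pi> x) \<delta> \<noteq> {} \<and> path_image' p \<inter> cball (\<pi> y) \<delta> \<noteq> {}))"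

definition constricting_element ::
  "('g, 'b) monoid_scheme \<Rightarrow> ('g \<Rightarrow> 'x::metric_space \<Rightarrow> 'x) \<Rightarrow> 'x path set \<Rightarrow> 'g \<Rightarrow> bool" where
  "constricting_element G \<phi> \<Gamma> g \<longleftrightarrow> g \<in> carrier G \<and>
     (\<forall>n::nat. n > 0 \<longrightarrow> g [^]\<^bsub>G\<^esub> n \<noteq> \<one>\<^bsub>G\<^esub>) \<and>
     (\<exists>\<delta> A. invariant_set (generate G {g}) \<phi> A \<and> constricting_set \<Gamma> \<delta> A \<and>
            acts_coboundedly (generate G {g}) \<phi> A \<delta>)"

definition growth_rate :: "(real \<Rightarrow> nat) \<Rightarrow> ereal" where
  "growth_rate N = Limsup at_top (\<lambda>r::real. ereal (ln (real (N r)) / r))"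

definition omega_G :: "('g, 'b) monoid_scheme \<Rightarrow> ('g \<Rightarrow> 'x::metric_space \<Rightarrow> 'x) \<Rightarrow> 'x \<Rightarrow> ereal" where
  "omega_G G \<phi> x0 = growth_rate (\<lambda>r. card (gball G \<phi> x0 r))"

definition omega_left ::
  "('g, 'b) monoid_scheme \<Rightarrow> ('g \<Rightarrow> 'x::metric_space \<Rightarrow> 'x) \<Rightarrow> 'g set \<Rightarrow> 'x \<Rightarrow> ereal" where
  "omega_left G \<phi> H x0 = growth_rate (\<lambda>r. card ((\<lambda>g. l_coset G g H) ` gball G \<phi> x0 r))"

definition omega_right ::
  "('g, 'b) monoid_scheme \<Rightarrow> ('g \<Rightarrow> 'x::metric_space \<Rightarrow> 'x) \<Rightarrow> 'g set \<Rightarrow> 'x \<Rightarrow> ereal" where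
  "omega_right G \<phi> H x0 = growth_rate (\<lambda>r. card ((\<lambda>g. r_coset G H g) ` gball G \<phi> x0 r))"

end

theory Submission
  imports Defs
begin

text \<open>
  Inversion identifies left and right cosets meeting a ball, so only right cosets matter. Let \<open>f\<close> be
  constricting with axis \<open>A\<close> and let \<open>H\<close> act coboundedly on the quasi-convex set \<open>Y\<close>.

  Some translate \<open>wA\<close> has bounded projection of \<open>Y\<close>: otherwise there is a finite set \<open>F\<close> such that for
  every \<open>w\<close> infinitely many \<open>k\<close> satisfy \<open>w f\<^sup>k \<in> HF\<close>, so that the orbit of \<open>Hw\<close> under \<open>\<langle>f\<rangle>\<close> is finite
  and one of finitely many orbits, and \<open>H\<close> has finite index.

  Fix such a \<open>w\<close>. If the projections to \<open>wA\<close> of \<open>u g x\<^sub>0\<close> and of \<open>u g' x\<^sub>0\<close> are far from that of \<open>Y\<close>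
  and \<open>h u g' = u g\<close> with \<open>h \<in> H\<close>, then a path from \<open>y\<^sub>0 \<in> Y\<close> to \<open>u g x\<^sub>0\<close> passes near \<open>h y\<^sub>0\<close>, and
  as it cannot backtrack, \<open>h y\<^sub>0\<close> is near \<open>y\<^sub>0\<close>. Hence \<open>g \<mapsto> H u g\<close> is uniformly finite-to-one on
  these \<open>g\<close>. For large \<open>N\<close> each \<open>g\<close> satisfies the condition for \<open>u = w\<close> or for \<open>u = w f\<^sup>N\<close>.
\<close>

section \<open>Constricting projections\<close>

text \<open>Names the map that \<open>constricting_set\<close> hides behind an existential, so that
  it can be translated by group elements and compared with another projection onto the same
  set.\<close>

definition constricting_projection ::
  "'x::metric_space path set \<Rightarrow> real \<Rightarrow> 'x set \<Rightarrow> ('x \<Rightarrow> 'x) \<Rightarrow> bool" where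
  "constricting_projection \<Gamma> \<delta> A \<pi> \<longleftrightarrow> range \<pi> \<subseteq> A \<and> (\<forall>x\<in>A. dist x (\<pi> x) \<le> \<delta>) \<and>
     (\<forall>a b \<alpha>. (a, b, \<alpha>) \<in> \<Gamma> \<longrightarrow> dist (\<pi> (\<alpha> a)) (\<pi> (\<alpha> b)) > \<delta> \<longrightarrow>
        (\<exists>t\<in>{a..b}. dist (\<pi> (\<alpha> a)) (\<alpha> t) \<le> \<delta>) \<and> (\<exists>t\<in>{a..b}. dist (\<pi> (\<alpha> b)) (\<alpha> t) \<le> \<delta>))"

lemma constricting_set_iff_projection:
  "constricting_set \<Gamma> \<delta> A \<longleftrightarrow> (\<exists>\<pi>. constricting_projection \<Gamma> \<delta> A \<pi>)"
proof -
  have ball: "path_image' (a, b, \<alpha>) \<inter> cball c \<delta> \<noteq> {} \<longleftrightarrow> (\<exists>t\<in>{a..b}. dist c (\<alpha> t) \<le> \<delta>)"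
    for a b \<alpha> and c :: 'a
    by (auto simp: path_image'_def)
  show ?thesis
    unfolding constricting_set_def constricting_projection_def Ball_def[of \<Gamma>] split_paired_All
      ball start_pt_def end_pt_def
    by (rule ex_cong1) (auto simp: image_subset_iff)
qed

lemma constricting_projectionD:
  assumes "constricting_projection \<Gamma> \<delta> A \<pi>"
  shows "\<pi> x \<in> A" "x \<in> A \<Longrightarrow> dist x (\<pi> x) \<le> \<delta>"
  using assms by (auto simp: constricting_projection_def)

lemma constricting_projection_nonneg:
  assumes "constricting_projection \<Gamma> \<delta> A \<pi>"
  shows "0 \<le> \<delta>"
  using constricting_projectionD(2)[OF assms constricting_projectionD(1)[OF assms]]
  by (meson order_trans zero_le_dist)

section \<open>Coarse geometry of constricting projections along paths\<close>

locale path_space =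
  fixes \<Gamma> :: "'x::metric_space path set" and \<mu> \<nu> :: real
  assumes path_system: "path_system \<mu> \<nu> \<Gamma>"
    and nonneg: "0 \<le> \<mu>" "0 \<le> \<nu>"
begin

lemma joining_path:
  obtains a b \<alpha> where "(a, b, \<alpha>) \<in> \<Gamma>" "a \<le> b" "\<alpha> a = x" "\<alpha> b = y"
proof -
  obtain p where p: "p \<in> \<Gamma>" "start_pt p = x" "end_pt p = y" "is_path p"
    using path_system unfolding path_system_def by metis
  obtain a b \<alpha> where "p = (a, b, \<alpha>)" by (cases p)
  with p that show thesis
    by (auto simp: start_pt_def end_pt_def is_path_def)
qed

lemma path_bounds:
  assumes "(a, b, \<alpha>) \<in> \<Gamma>" "t \<in> {a..b}" "t' \<in> {a..b}"
  shows "dist (\<alpha> t) (\<alpha> t') \<le> \<bar>t - t'\<bar>" "\<bar>t - t'\<bar> \<le> \<mu> * dist (\<alpha> t) (\<alpha> t') + \<nu>"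
proof -
  have "quasi_geodesic \<mu> \<nu> (a, b, \<alpha>)"
    using path_system assms(1) unfolding path_system_def by blast
  with assms(2,3) show "dist (\<alpha> t) (\<alpha> t') \<le> \<bar>t - t'\<bar>" "\<bar>t - t'\<bar> \<le> \<mu> * dist (\<alpha> t) (\<alpha> t') + \<nu>"
    unfolding quasi_geodesic_def prod.case by blast+
qed

text \<open>Closure of \<Gamma> under subpaths lets (CS2) be applied on \<open>{s..t}\<close>. This
  locates the meeting points in a chosen parameter interval; the later arguments compare such
  parameters.\<close>

lemma subpath_meets_balls:
  assumes "constricting_projection \<Gamma> \<delta> A \<pi>" "(a, b, \<alpha>) \<in> \<Gamma>" "a \<le> s" "s \<le> t" "t \<le> b"
    and "dist (\<pi> (\<alpha> s)) (\<pi> (\<alpha> t)) > \<delta>"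
  shows "\<exists>r\<in>{s..t}. dist (\<pi> (\<alpha> s)) (\<alpha> r) \<le> \<delta>" "\<exists>r\<in>{s..t}. dist (\<pi> (\<alpha> t)) (\<alpha> r) \<le> \<delta>"
proof -
  have "(s, t, \<alpha>) \<in> \<Gamma>"
    using path_system assms unfolding path_system_def by metis
  with assms show "\<exists>r\<in>{s..t}. dist (\<pi> (\<alpha> s)) (\<alpha> r) \<le> \<delta>" "\<exists>r\<in>{s..t}. dist (\<pi> (\<alpha> t)) (\<alpha> r) \<le> \<delta>"
    unfolding constricting_projection_def by blast+
qed

text \<open>Two projections more than \<delta> apart both lie within \<delta> of one path from
  \<open>x\<close> to \<open>y\<close>, and the quasi-geodesic inequality bounds the parameter
  length of that path by \<open>\<mu> * dist x y + \<nu>\<close>.\<close>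

lemma projection_coarse_lipschitz:
  assumes \<pi>: "constricting_projection \<Gamma> \<delta> A \<pi>"
  shows "dist (\<pi> x) (\<pi> y) \<le> \<mu> * dist x y + \<nu> + 2 * \<delta>"
proof (cases "dist (\<pi> x) (\<pi> y) > \<delta>")
  case True
  obtain a b \<alpha> where p: "(a, b, \<alpha>) \<in> \<Gamma>" "a \<le> b" "\<alpha> a = x" "\<alpha> b = y"
    by (rule joining_path)
  obtain s t where st: "s \<in> {a..b}" "dist (\<pi> x) (\<alpha> s) \<le> \<delta>" "t \<in> {a..b}" "dist (\<pi> y) (\<alpha> t) \<le> \<delta>"
    using subpath_meets_balls[OF \<pi> p(1), of a b] p True by auto
  have "dist (\<alpha> s) (\<alpha> t) \<le> \<bar>s - t\<bar>" by (rule path_bounds(1)[OF p(1) st(1,3)])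
  also have "\<dots> \<le> \<bar>a - b\<bar>" using st by auto
  also have "\<dots> \<le> \<mu> * dist x y + \<nu>"
    using path_bounds(2)[OF p(1), of a b] p by simp
  finally have "dist (\<alpha> s) (\<alpha> t) \<le> \<mu> * dist x y + \<nu>" .
  moreover have "dist (\<pi> x) (\<pi> y) \<le> dist (\<pi> x) (\<alpha> s) + dist (\<alpha> s) (\<alpha> t) + dist (\<pi> y) (\<alpha> t)"
    by metric
  ultimately show ?thesis using st by linarith
next
  case False
  moreover have "0 \<le> \<mu> * dist x y" using nonneg by simp
  ultimately show ?thesis
    using nonneg constricting_projection_nonneg[OF \<pi>] by linarith
qed

lemma projection_near:
  assumes \<pi>: "constricting_projection \<Gamma> \<delta> A \<pi>" and "c \<in> A" "dist x c \<le> r"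
  shows "dist (\<pi> x) c \<le> \<mu> * r + \<nu> + 3 * \<delta>"
proof -
  have "dist (\<pi> x) (\<pi> c) \<le> \<mu> * dist x c + \<nu> + 2 * \<delta>"
    by (rule projection_coarse_lipschitz[OF \<pi>])
  moreover have "\<mu> * dist x c \<le> \<mu> * r"
    using assms nonneg by (intro mult_left_mono)
  moreover have "dist (\<pi> c) c \<le> \<delta>"
    using constricting_projectionD(2)[OF \<pi> assms(2)] by (simp add: dist_commute)
  moreover have "dist (\<pi> x) c \<le> dist (\<pi> x) (\<pi> c) + dist (\<pi> c) c" by metric
  ultimately show ?thesis by linarith
qed

text \<open>Follow a path from \<open>x\<close> to \<open>\<pi>' x\<close>. Unless the bound is
  immediate, it passes near \<open>\<pi> x\<close> at a time \<open>t\<close>, and near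
  \<open>\<pi>' x\<close> at a time \<open>s\<close> no later than \<open>t\<close>. Since it also
  ends at \<open>\<pi>' x\<close>, little time is left after \<open>s\<close>, so
  \<open>\<alpha> t\<close>, and with it \<open>\<pi> x\<close>, is close to
  \<open>\<pi>' x\<close>.\<close>

lemma projection_coarsely_unique:
  assumes \<pi>: "constricting_projection \<Gamma> \<delta> A \<pi>" and \<pi>': "constricting_projection \<Gamma> \<delta> A \<pi>'"
  shows "dist (\<pi> x) (\<pi>' x) \<le> \<mu> * \<delta> + \<nu> + 4 * \<delta>"
proof -
  have \<delta>: "0 \<le> \<delta>" by (rule constricting_projection_nonneg[OF \<pi>])
  have \<mu>\<delta>: "0 \<le> \<mu> * \<delta>" using \<delta> nonneg by simp
  obtain a b \<alpha> where p: "(a, b, \<alpha>) \<in> \<Gamma>" "a \<le> b" "\<alpha> a = x" "\<alpha> b = \<pi>' x"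
    by (rule joining_path)
  have end_near: "dist (\<pi>' x) (\<pi> (\<pi>' x)) \<le> \<delta>"
    by (intro constricting_projectionD(2)[OF \<pi>] constricting_projectionD(1)[OF \<pi>'])
  show ?thesis
  proof (cases "dist (\<pi> x) (\<pi> (\<pi>' x)) > \<delta>")
    case True
    then obtain t where t: "t \<in> {a..b}" "dist (\<pi> x) (\<alpha> t) \<le> \<delta>"
      using subpath_meets_balls(1)[OF \<pi> p(1), of a b] p by auto
    have near: "dist (\<pi>' (\<alpha> t)) (\<pi> x) \<le> \<mu> * \<delta> + \<nu> + 3 * \<delta>"
      using t by (intro projection_near[OF \<pi>'] constricting_projectionD(1)[OF \<pi>])
        (simp add: dist_commute)
    show ?thesis
    proof (cases "dist (\<pi>' x) (\<pi>' (\<alpha> t)) > \<delta>")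
      case True
      then obtain s where s: "s \<in> {a..t}" "dist (\<pi>' x) (\<alpha> s) \<le> \<delta>"
        using subpath_meets_balls(1)[OF \<pi>' p(1), of a t] p t by auto
      have "dist (\<alpha> t) (\<pi>' x) \<le> \<bar>t - b\<bar>"
        using path_bounds(1)[OF p(1), of t b] p t by auto
      also have "\<dots> \<le> \<bar>s - b\<bar>" using s t by auto
      also have "\<dots> \<le> \<mu> * dist (\<alpha> s) (\<pi>' x) + \<nu>"
        using path_bounds(2)[OF p(1), of s b] p s t by auto
      also have "\<dots> \<le> \<mu> * \<delta> + \<nu>"
        using s nonneg by (simp add: dist_commute mult_left_mono)
      finally have "dist (\<alpha> t) (\<pi>' x) \<le> \<mu> * \<delta> + \<nu>" .
      moreover have "dist (\<pi> x) (\<pi>' x) \<le> dist (\<pi> x) (\<alpha> t) + dist (\<alpha> t) (\<pi>' x)" by metric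
      ultimately show ?thesis using t \<delta> by linarith
    next
      case False
      moreover have "dist (\<pi> x) (\<pi>' x) \<le> dist (\<pi>' x) (\<pi>' (\<alpha> t)) + dist (\<pi>' (\<alpha> t)) (\<pi> x)"
        by metric
      ultimately show ?thesis using near \<delta> by linarith
    qed
  next
    case False
    moreover have "dist (\<pi> x) (\<pi>' x) \<le> dist (\<pi> x) (\<pi> (\<pi>' x)) + dist (\<pi>' x) (\<pi> (\<pi>' x))"
      by metric
    ultimately show ?thesis using end_near \<delta> \<mu>\<delta> nonneg by linarith
  qed
qed

text \<open>Between time \<open>q\<close> and a visit near the projection of its end, the path comes
  close to \<open>\<pi> (\<alpha> q)\<close>, hence close to its own start, and the quasi-geodesic
  inequality allows this only at small parameters.\<close>

lemma no_backtracking: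
  assumes \<pi>: "constricting_projection \<Gamma> \<delta> A \<pi>"
    and p: "(a, b, \<alpha>) \<in> \<Gamma>" and q: "q \<in> {a..b}"
    and e: "dist (\<pi> (\<alpha> q)) (\<pi> (\<alpha> a)) \<le> e" and E: "dist (\<alpha> a) (\<pi> (\<alpha> a)) \<le> E"
    and far: "dist (\<pi> (\<alpha> a)) (\<pi> (\<alpha> b)) >
      \<mu> * \<delta> + \<nu> + 4 * \<delta> + e + E + (\<mu> * (\<delta> + e + E) + \<nu>)"
  shows "dist (\<alpha> a) (\<alpha> q) \<le> \<mu> * (\<delta> + e + E) + \<nu>"
proof -
  define C where "C = \<mu> * (\<delta> + e + E) + \<nu>"
  have \<delta>: "0 \<le> \<delta>" by (rule constricting_projection_nonneg[OF \<pi>])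
  have eE: "0 \<le> e" "0 \<le> E" using e E zero_le_dist order_trans by blast+
  have pos: "0 \<le> \<mu> * \<delta>" "0 \<le> C" using \<delta> eE nonneg by (auto simp: C_def)
  have ab: "a \<le> b" using q by simp
  have "dist (\<pi> (\<alpha> a)) (\<pi> (\<alpha> b)) > \<delta>"
    using far[folded C_def] pos \<delta> eE nonneg by linarith
  then obtain t where t: "t \<in> {a..b}" "dist (\<pi> (\<alpha> b)) (\<alpha> t) \<le> \<delta>"
    using subpath_meets_balls(2)[OF \<pi> p, of a b] ab by auto
  have "dist (\<pi> (\<alpha> t)) (\<pi> (\<alpha> b)) \<le> \<mu> * \<delta> + \<nu> + 3 * \<delta>"
    using t by (intro projection_near[OF \<pi>] constricting_projectionD(1)[OF \<pi>])
      (simp add: dist_commute)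
  moreover have "dist (\<pi> (\<alpha> a)) (\<pi> (\<alpha> b)) \<le> dist (\<pi> (\<alpha> q)) (\<pi> (\<alpha> a)) + dist (\<pi> (\<alpha> q)) (\<pi> (\<alpha> t))
      + dist (\<pi> (\<alpha> t)) (\<pi> (\<alpha> b))"
    by metric
  ultimately have sep: "dist (\<pi> (\<alpha> q)) (\<pi> (\<alpha> t)) > \<delta>"
    using far[folded C_def] e eE pos by linarith
  \<comment> \<open>The \<delta>-ball about \<open>\<pi> (\<alpha> q)\<close> lies within
    \<open>\<delta> + e + E\<close> of \<open>\<alpha> a\<close>, so the path can visit it only up
    to time \<open>a + C\<close>.\<close>
  have return: "s - a \<le> C" if "s \<in> {a..b}" "dist (\<pi> (\<alpha> q)) (\<alpha> s) \<le> \<delta>" for s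
  proof -
    have "dist (\<alpha> s) (\<alpha> a) \<le> dist (\<pi> (\<alpha> q)) (\<alpha> s) + dist (\<pi> (\<alpha> q)) (\<pi> (\<alpha> a)) + dist (\<alpha> a) (\<pi> (\<alpha> a))"
      by metric
    then have "dist (\<alpha> s) (\<alpha> a) \<le> \<delta> + e + E" using that e E by linarith
    then have "\<mu> * dist (\<alpha> s) (\<alpha> a) \<le> \<mu> * (\<delta> + e + E)" using nonneg by (intro mult_left_mono)
    then show ?thesis using path_bounds(2)[OF p, of s a] that by (auto simp: C_def)
  qed
  have from_start: "dist (\<alpha> a) (\<alpha> r) \<le> r - a" if "r \<in> {a..b}" for r
    using path_bounds(1)[OF p, of a r] that by auto
  \<comment> \<open>If \<open>t \<le> q\<close>, the visit happens after \<open>t\<close>, so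
    \<open>\<alpha> t\<close> is near the start although it is also near the far projection of the
    end, against \<open>far\<close>. Otherwise the visit happens after \<open>q\<close>, which
    bounds \<open>q - a\<close>.\<close>
  show ?thesis
  proof (cases "t \<le> q")
    case True
    then obtain s where s: "s \<in> {t..q}" "dist (\<pi> (\<alpha> q)) (\<alpha> s) \<le> \<delta>"
      using subpath_meets_balls(2)[OF \<pi> p, of t q] t q sep by (auto simp: dist_commute)
    have "dist (\<alpha> a) (\<alpha> t) \<le> C"
      using return[of s] from_start[OF t(1)] s t q by auto
    moreover have "dist (\<pi> (\<alpha> a)) (\<pi> (\<alpha> b)) \<le>
        dist (\<alpha> a) (\<pi> (\<alpha> a)) + dist (\<alpha> a) (\<alpha> t) + dist (\<pi> (\<alpha> b)) (\<alpha> t)"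
      by metric
    ultimately have False using far[folded C_def] E t pos \<delta> eE nonneg by linarith
    then show ?thesis ..
  next
    case False
    then obtain s where s: "s \<in> {q..t}" "dist (\<pi> (\<alpha> q)) (\<alpha> s) \<le> \<delta>"
      using subpath_meets_balls(1)[OF \<pi> p, of q t] t q sep by auto
    then show ?thesis
      using return[of s] from_start[OF q] t q unfolding C_def[symmetric] by auto
  qed
qed

end

section \<open>Growth rates\<close>

lemma growth_rate_mono:
  assumes "\<And>r. 0 \<le> r \<Longrightarrow> 0 < M r" "\<And>r. 0 \<le> r \<Longrightarrow> M r \<le> N r"
  shows "growth_rate M \<le> growth_rate N"
  unfolding growth_rate_def
proof (rule Limsup_mono)
  show "\<forall>\<^sub>F r in at_top. ereal (ln (real (M r)) / r) \<le> ereal (ln (real (N r)) / r)"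
    using eventually_gt_at_top[of 0]
  proof eventually_elim
    case (elim r)
    then have "0 < M r" "M r \<le> N r" using assms by auto
    then show ?case using elim by (simp add: divide_right_mono)
  qed
qed

text \<open>After taking logarithms and dividing by \<open>r\<close>, the factor \<open>K\<close>
  contributes \<open>ln K / r\<close> and the shift replaces \<open>r\<close> by
  \<open>r + c\<close>; both effects vanish in the limit.\<close>

lemma growth_rate_le_of_shift:
  fixes K c :: real
  assumes pos: "\<And>r. 0 \<le> r \<Longrightarrow> 0 < M r" "\<And>r. 0 \<le> r \<Longrightarrow> 0 < N r"
    and K: "0 < K" and c: "0 \<le> c"
    and le: "\<And>r. 0 \<le> r \<Longrightarrow> real (M r) \<le> K * real (N (r + c))"
  shows "growth_rate M \<le> growth_rate N"
proof (rule ccontr)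
  assume "\<not> ?thesis"
  then have "growth_rate N < growth_rate M" by simp
  \<comment> \<open>The rate \<open>m\<close> eventually bounds the quotients of \<open>N\<close>;
    the gap between \<open>m\<close> and \<open>m'\<close> absorbs the errors
    \<open>ln K / r\<close> and \<open>m * c / r\<close>.\<close>
  then obtain m where m: "growth_rate N < ereal m" "ereal m < growth_rate M"
    by (metis ereal_dense2)
  obtain m' where m': "ereal m < ereal m'" "ereal m' < growth_rate M"
    using ereal_dense2[OF m(2)] by blast
  have "\<forall>\<^sub>F r in at_top. ereal (ln (real (N r)) / r) < ereal m"
    using m(1) unfolding growth_rate_def by (rule Limsup_lessD)
  then have ev: "\<forall>\<^sub>F r in at_top. ln (real (N r)) / r < m" by simp
  have ev': "\<forall>\<^sub>F r in at_top. ln (real (N (r + c))) / (r + c) < m"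
    using filterlim_tendsto_add_at_top[OF tendsto_const[of c] filterlim_ident] ev
    by (auto simp: filterlim_iff add.commute)
  have "((\<lambda>r. ln K / r + m * (1 + c / r)) \<longlongrightarrow> 0 + m * (1 + 0)) at_top"
    by (intro tendsto_intros tendsto_divide_0[OF tendsto_const] filterlim_at_top_imp_at_infinity
        filterlim_ident)
  then have ev'': "\<forall>\<^sub>F r in at_top. ln K / r + m * (1 + c / r) < m'"
    using m'(1) by (intro order_tendstoD) auto
  have "\<forall>\<^sub>F r in at_top. ereal (ln (real (M r)) / r) \<le> ereal m'"
    using ev' ev'' eventually_gt_at_top[of 0]
  proof eventually_elim
    case (elim r)
    have NM: "0 < real (N (r + c))" "0 < real (M r)" using pos elim c by auto
    have "ln (real (M r)) \<le> ln (K * real (N (r + c)))"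
      using le[of r] NM elim K by simp
    also have "\<dots> = ln K + ln (real (N (r + c)))" using NM K by (simp add: ln_mult)
    also have "\<dots> \<le> ln K + m * (r + c)"
      using elim c by (simp add: divide_simps)
    finally have "ln (real (M r)) / r \<le> (ln K + m * (r + c)) / r"
      using elim by (simp add: divide_right_mono)
    also have "\<dots> = ln K / r + m * (1 + c / r)" using elim by (simp add: field_simps)
    also have "\<dots> \<le> m'" using elim by simp
    finally show ?case by simp
  qed
  then have "growth_rate M \<le> ereal m'" unfolding growth_rate_def by (rule Limsup_bounded)
  with m'(2) show False by simp
qed

section \<open>Coset counting\<close>

context group
begin

text \<open>The elements fixing \<open>H #> x\<close> under right multiplication form a subgroup
  \<open>S\<close> containing \<open>f [^] m\<close>, so only exponents modulo \<open>m\<close>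
  matter.\<close>

lemma finite_coset_orbit:
  fixes m :: int
  assumes H: "subgroup H G" and x: "x \<in> carrier G" and f: "f \<in> carrier G" and m: "m > 0"
    and stab: "H #> (x \<otimes> f [^] m) = H #> x"
  shows "finite ((\<lambda>t. H #> (x \<otimes> t)) ` generate G {f})"
proof -
  have HG: "H \<subseteq> carrier G" by (rule subgroup.subset[OF H])
  define M where "M = H #> x"
  have M: "M \<subseteq> carrier G" unfolding M_def by (rule r_coset_subset_G[OF HG x])
  have split: "H #> (x \<otimes> t) = M #> t" if "t \<in> carrier G" for t
    unfolding M_def by (rule coset_mult_assoc[OF HG x that, symmetric])
  define S where "S = {s \<in> carrier G. M #> s = M}"
  have S: "subgroup S G"
  proof (rule subgroupI)
    show "S \<subseteq> carrier G" "S \<noteq> {}" using coset_mult_one[OF M] by (auto simp: S_def)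
    show "inv s \<in> S" if "s \<in> S" for s
      using that coset_mult_assoc[OF M, of s "inv s"] coset_mult_one[OF M] by (auto simp: S_def)
    show "s \<otimes> t \<in> S" if "s \<in> S" "t \<in> S" for s t
      using that coset_mult_assoc[OF M, of s t] by (auto simp: S_def)
  qed
  have "f [^] m \<in> S" using stab split[of "f [^] m"] f by (simp add: S_def M_def)
  then have powS: "f [^] (m * q) \<in> S" for q :: int
    using subgroup_int_pow_closed[OF S, of "f [^] m" q] int_pow_pow[OF f] by simp
  have "(\<lambda>t. H #> (x \<otimes> t)) ` generate G {f} \<subseteq> (\<lambda>j::int. M #> f [^] j) ` {0..<m}"
  proof (rule image_subsetI)
    fix t assume "t \<in> generate G {f}"
    then obtain k :: int where t: "t = f [^] k" using generate_pow[OF f] by blast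
    have "f [^] k = f [^] (m * (k div m)) \<otimes> f [^] (k mod m)"
      using int_pow_mult[OF f, of "m * (k div m)" "k mod m"] by simp
    then have "M #> t = M #> f [^] (m * (k div m)) #> f [^] (k mod m)"
      using coset_mult_assoc[OF M] f t by simp
    also have "\<dots> = M #> f [^] (k mod m)" using powS by (simp add: S_def)
    finally have "H #> (x \<otimes> t) = M #> f [^] (k mod m)" using split f t by simp
    moreover have "k mod m \<in> {0..<m}" using m by simp
    ultimately show "H #> (x \<otimes> t) \<in> (\<lambda>j::int. M #> f [^] j) ` {0..<m}" by blast
  qed
  then show ?thesis by (rule finite_subset) simp
qed

text \<open>Inversion carries \<open>g <# H\<close> to \<open>H #> inv g\<close>, is injective on
  subsets of the carrier, and preserves \<open>B\<close>.\<close>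

lemma card_left_cosets_eq_right_cosets:
  assumes H: "subgroup H G" and B: "B \<subseteq> carrier G" and inv_B: "\<And>g. g \<in> B \<Longrightarrow> inv g \<in> B"
  shows "card ((\<lambda>g. g <# H) ` B) = card ((\<lambda>g. H #> g) ` B)"
proof -
  have coset_inv: "m_inv G ` (g <# H) = H #> inv g" if g: "g \<in> carrier G" for g
  proof
    show "m_inv G ` (g <# H) \<subseteq> H #> inv g"
      using g H subgroup.m_inv_closed[OF H]
      by (auto simp: l_coset_def r_coset_def inv_mult_group subgroup.mem_carrier)
    show "H #> inv g \<subseteq> m_inv G ` (g <# H)"
    proof
      fix z assume "z \<in> H #> inv g"
      then obtain h where h: "h \<in> H" "z = h \<otimes> inv g" by (auto simp: r_coset_def)
      then have "z = inv (g \<otimes> inv h)"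
        using g by (simp add: inv_mult_group subgroup.mem_carrier[OF H])
      moreover have "g \<otimes> inv h \<in> g <# H"
        using subgroup.m_inv_closed[OF H h(1)] by (auto simp: l_coset_def)
      ultimately show "z \<in> m_inv G ` (g <# H)" by blast
    qed
  qed
  have "(\<lambda>g. H #> g) ` B = (\<lambda>S. m_inv G ` S) ` (\<lambda>g. g <# H) ` B"
  proof -
    have "(\<lambda>g. H #> g) ` B = (\<lambda>g. H #> inv g) ` B"
    proof
      show "(\<lambda>g. H #> g) ` B \<subseteq> (\<lambda>g. H #> inv g) ` B"
      proof (rule image_subsetI)
        fix g assume g: "g \<in> B"
        then have "H #> g = H #> inv (inv g)" using B by auto
        with inv_B[OF g] show "H #> g \<in> (\<lambda>g. H #> inv g) ` B" by blast
      qed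
      show "(\<lambda>g. H #> inv g) ` B \<subseteq> (\<lambda>g. H #> g) ` B" using inv_B by blast
    qed
    also have "\<dots> = (\<lambda>S. m_inv G ` S) ` (\<lambda>g. g <# H) ` B"
      unfolding image_image using B by (intro image_cong) (auto simp: coset_inv subset_iff)
    finally show ?thesis .
  qed
  moreover have "inj_on (\<lambda>S. m_inv G ` S) ((\<lambda>g. g <# H) ` B)"
  proof (rule inj_on_subset[OF inj_on_image_Pow])
    show "inj_on (m_inv G) (carrier G)" by (auto intro!: inj_onI dest: inv_inj[THEN inj_onD])
    show "(\<lambda>g. g <# H) ` B \<subseteq> Pow (carrier G)"
      using B subgroup.subset[OF H] l_coset_subset_G by blast
  qed
  ultimately show ?thesis by (simp add: card_image)
qed

text \<open>Fix a representative in \<open>B\<close> over each coset. Then \<open>g\<close> is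
  determined by its coset and the element of \<open>H\<close> carrying
  \<open>u \<otimes> rep (m g)\<close> to \<open>u \<otimes> g\<close>; \<open>fibre\<close> puts
  that element in \<open>F\<close>, so \<open>B\<close> injects into
  \<open>F \<times> C\<close>.\<close>

lemma card_le_of_coset_fibres:
  assumes H: "subgroup H G" and u: "u \<in> carrier G" and B: "B \<subseteq> carrier G"
    and F: "finite F" and C: "finite C" and img: "\<And>g. g \<in> B \<Longrightarrow> H #> (u \<otimes> g) \<in> C"
    and fibre: "\<And>g g' h. g \<in> B \<Longrightarrow> g' \<in> B \<Longrightarrow> h \<in> H \<Longrightarrow> u \<otimes> g = h \<otimes> (u \<otimes> g') \<Longrightarrow> h \<in> F"
  shows "card B \<le> card F * card C"
proof -
  define m where "m g = H #> (u \<otimes> g)" for g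
  define rep where "rep S = (SOME g. g \<in> B \<and> m g = S)" for S
  have rep: "rep (m g) \<in> B" "m (rep (m g)) = m g" if "g \<in> B" for g
    using someI[of "\<lambda>g'. g' \<in> B \<and> m g' = m g" g] that by (auto simp: rep_def)
  have "\<exists>h. h \<in> F \<and> u \<otimes> g = h \<otimes> (u \<otimes> rep (m g))" if g: "g \<in> B" for g
  proof -
    have "u \<otimes> g \<in> H #> (u \<otimes> rep (m g))"
      using rep[OF g] g u B by (intro repr_independenceD[OF H]) (auto simp: m_def)
    then obtain h where "h \<in> H" "u \<otimes> g = h \<otimes> (u \<otimes> rep (m g))" by (auto simp: r_coset_def)
    with fibre[OF g rep(1)[OF g]] show ?thesis by blast
  qed
  then obtain k where k: "\<And>g. g \<in> B \<Longrightarrow> k g \<in> F" "\<And>g. g \<in> B \<Longrightarrow> u \<otimes> g = k g \<otimes> (u \<otimes> rep (m g))"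
    by metis
  have "inj_on (\<lambda>g. (k g, m g)) B"
  proof (rule inj_onI)
    fix g g' assume gg: "g \<in> B" "g' \<in> B" "(k g, m g) = (k g', m g')"
    then have "u \<otimes> g = u \<otimes> g'" using k(2)[OF gg(1)] k(2)[OF gg(2)] by simp
    with gg(1,2) u B show "g = g'" by (simp add: subset_iff)
  qed
  moreover have "(\<lambda>g. (k g, m g)) ` B \<subseteq> F \<times> C" using k img by (auto simp: m_def)
  ultimately have "card B \<le> card (F \<times> C)" using F C by (intro card_inj_on_le) auto
  then show ?thesis by (simp add: card_cartesian_product)
qed

end

section \<open>Path system groups\<close>

locale path_group = group G + path_space \<Gamma> \<mu> \<nu>
  for G :: "('g, 'b) monoid_scheme" (structure)
    and \<Gamma> :: "'x::metric_space path set" and \<mu> \<nu> :: real +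
  fixes \<phi> :: "'g \<Rightarrow> 'x \<Rightarrow> 'x"
  assumes action: "isometric_action G \<phi>"
    and proper: "proper_action G \<phi>"
    and path_invariant: "g \<in> carrier G \<Longrightarrow> (a, b, \<alpha>) \<in> \<Gamma> \<Longrightarrow> (a, b, \<phi> g \<circ> \<alpha>) \<in> \<Gamma>"
begin

lemma act_one [simp]: "\<phi> \<one> x = x"
  and act_mult: "g \<in> carrier G \<Longrightarrow> h \<in> carrier G \<Longrightarrow> \<phi> (g \<otimes> h) x = \<phi> g (\<phi> h x)"
  and act_dist [simp]: "g \<in> carrier G \<Longrightarrow> dist (\<phi> g x) (\<phi> g y) = dist x y"
  using action by (auto simp: isometric_action_def)

lemma act_inv [simp]:
  assumes "g \<in> carrier G"
  shows "\<phi> g (\<phi> (inv g) x) = x" "\<phi> (inv g) (\<phi> g x) = x"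
  using assms act_mult[of g "inv g" x] act_mult[of "inv g" g x] by auto

lemma dist_act_left:
  assumes "g \<in> carrier G"
  shows "dist (\<phi> g x) y = dist x (\<phi> (inv g) y)"
  using act_dist[OF assms, of x "\<phi> (inv g) y"] assms by simp

text \<open>Properness controls how far \<open>g\<close> moves a single point; comparing with a
  second point enlarges the radius by \<open>dist x y\<close>.\<close>

lemma finite_orbit_near: "finite {g \<in> carrier G. dist x (\<phi> g y) \<le> r}"
proof (rule finite_subset)
  show "{g \<in> carrier G. dist x (\<phi> g y) \<le> r} \<subseteq> gball G \<phi> x (r + dist x y)"
  proof
    fix g assume g: "g \<in> {g \<in> carrier G. dist x (\<phi> g y) \<le> r}"
    then have "dist (\<phi> g y) (\<phi> g x) = dist y x" by simp
    moreover have "dist x (\<phi> g x) \<le> dist x (\<phi> g y) + dist (\<phi> g y) (\<phi> g x)" by metric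
    ultimately show "g \<in> gball G \<phi> x (r + dist x y)"
      using g by (simp add: gball_def dist_commute)
  qed
  show "finite (gball G \<phi> x (r + dist x y))" using proper by (simp add: proper_action_def)
qed

section \<open>Translates of constricting projections\<close>

definition translate :: "'g \<Rightarrow> ('x \<Rightarrow> 'x) \<Rightarrow> 'x \<Rightarrow> 'x" where
  "translate g \<pi> x = \<phi> g (\<pi> (\<phi> (inv g) x))"

text \<open>Apply (CS2) for \<pi> to the path moved by \<open>inv g\<close>, which is again in
  \<Gamma>, and move the conclusion back by the isometry \<open>g\<close>.\<close>

lemma constricting_projection_translate:
  assumes \<pi>: "constricting_projection \<Gamma> \<delta> A \<pi>" and g: "g \<in> carrier G"
  shows "constricting_projection \<Gamma> \<delta> (\<phi> g ` A) (translate g \<pi>)"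
  unfolding constricting_projection_def
proof (intro conjI allI impI ballI)
  show "range (translate g \<pi>) \<subseteq> \<phi> g ` A"
    using constricting_projectionD(1)[OF \<pi>] by (auto simp: translate_def)
  show "dist x (translate g \<pi> x) \<le> \<delta>" if "x \<in> \<phi> g ` A" for x
    using that g constricting_projectionD(2)[OF \<pi>] by (auto simp: translate_def)
next
  fix a b \<alpha>
  assume p: "(a, b, \<alpha>) \<in> \<Gamma>" and far: "dist (translate g \<pi> (\<alpha> a)) (translate g \<pi> (\<alpha> b)) > \<delta>"
  have "(a, b, \<phi> (inv g) \<circ> \<alpha>) \<in> \<Gamma>" using path_invariant p g by simp
  then have "(\<exists>t\<in>{a..b}. dist (\<pi> (\<phi> (inv g) (\<alpha> a))) (\<phi> (inv g) (\<alpha> t)) \<le> \<delta>) \<and>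
    (\<exists>t\<in>{a..b}. dist (\<pi> (\<phi> (inv g) (\<alpha> b))) (\<phi> (inv g) (\<alpha> t)) \<le> \<delta>)"
    using \<pi> far g unfolding constricting_projection_def translate_def by fastforce
  then show "\<exists>t\<in>{a..b}. dist (translate g \<pi> (\<alpha> a)) (\<alpha> t) \<le> \<delta>"
    and "\<exists>t\<in>{a..b}. dist (translate g \<pi> (\<alpha> b)) (\<alpha> t) \<le> \<delta>"
    using g by (auto simp: translate_def dist_act_left)
qed

section \<open>A translate of the axis onto which \<open>Y\<close> has bounded projection\<close>

lemma exists_bounded_projection:
  assumes \<pi>: "constricting_projection \<Gamma> \<delta> A \<pi>" and f: "f \<in> carrier G"
    and cobA: "acts_coboundedly (generate G {f}) \<phi> A \<delta>"
    and H: "subgroup H G" and Y: "Y \<noteq> {}" "quasi_convex_set \<Gamma> \<eta> Y"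
    and cobY: "acts_coboundedly H \<phi> Y \<eta>" and index: "infinite (rcosets H)"
  shows "\<exists>w\<in>carrier G. bounded (translate w \<pi> ` Y)"
proof (rule ccontr)
  assume "\<not> ?thesis"
  then have unbounded: "\<not> bounded (translate w \<pi> ` Y)" if "w \<in> carrier G" for w
    using that by blast
  obtain y0 where y0: "y0 \<in> Y" using Y by blast
  define c where "c = \<pi> y0"
  have c: "c \<in> A" unfolding c_def by (rule constricting_projectionD(1)[OF \<pi>])
  \<comment> \<open>The radius adds \<open>\<eta> + 1\<close> from the path to a point of
    \<open>Y\<close> (the \<open>1\<close> because the infimum distance need not be attained),
    \<eta> for moving \<open>y0\<close> near that point by \<open>H\<close>, \<delta> for the path
    meeting the ball, and \<delta> for moving \<open>c\<close> along the axis.\<close>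
  define F where "F = {g \<in> carrier G. dist y0 (\<phi> g c) \<le> 2 * \<eta> + 1 + 2 * \<delta>}"
  have finF: "finite F" unfolding F_def by (rule finite_orbit_near)
  have HG: "H \<subseteq> carrier G" by (rule subgroup.subset[OF H])
  have gen: "generate G {f} \<subseteq> carrier G" using f by (intro generate_incl) simp
  \<comment> \<open>Take \<open>y\<close>, \<open>y'\<close> in \<open>Y\<close> with projections
    far from each other and that of \<open>y\<close> far from \<open>\<phi> w c\<close>. A path
    joining them stays near \<open>Y\<close> and passes near \<open>P y\<close>, so an
    \<open>H\<close>-translate of \<open>y0\<close> is near \<open>\<phi> (w \<otimes> t) c\<close>,
    where \<open>t\<close> moves \<open>c\<close> beyond any prescribed \<open>M\<close>.\<close>
  have near: "\<exists>t\<in>generate G {f}. H #> (w \<otimes> t) \<in> (\<lambda>g. H #> g) ` F \<and> dist c (\<phi> t c) > M"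
    if w: "w \<in> carrier G" for w M
  proof -
    define P where "P = translate w \<pi>"
    have P: "constricting_projection \<Gamma> \<delta> (\<phi> w ` A) P"
      unfolding P_def by (rule constricting_projection_translate[OF \<pi> w])
    have unb: "\<exists>y\<in>Y. dist x (P y) > r" for x r
      using unbounded[OF w] unfolding bounded_any_center[where a = x] P_def
      by (metis (no_types, lifting) image_iff not_le)
    obtain y where y: "y \<in> Y" "dist (\<phi> w c) (P y) > M + \<delta>" using unb by blast
    obtain y' where y': "y' \<in> Y" "dist (P y) (P y') > \<delta>" using unb by blast
    obtain a b \<alpha> where p: "(a, b, \<alpha>) \<in> \<Gamma>" "a \<le> b" "\<alpha> a = y" "\<alpha> b = y'"
      by (rule joining_path)
    obtain s where s: "s \<in> {a..b}" "dist (P y) (\<alpha> s) \<le> \<delta>"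
      using subpath_meets_balls(1)[OF P p(1), of a b] p y' by auto
    have "path_image' (a, b, \<alpha>) \<subseteq> nbhd Y \<eta>"
      using Y(2) p y y' unfolding quasi_convex_set_def by (auto simp: start_pt_def end_pt_def)
    then have "infdist (\<alpha> s) Y < \<eta> + 1"
      using s by (fastforce simp: path_image'_def nbhd_def)
    then have "\<exists>y''\<in>Y. dist (\<alpha> s) y'' < \<eta> + 1"
      using Y(1) unfolding infdist_def by (simp add: cINF_less_iff)
    then obtain y'' where y'': "y'' \<in> Y" "dist (\<alpha> s) y'' < \<eta> + 1" by blast
    obtain h where h: "h \<in> H" "dist y'' (\<phi> h y0) \<le> \<eta>"
      using cobY y'' y0 unfolding acts_coboundedly_def by blast
    obtain t where t: "t \<in> generate G {f}" "dist (\<pi> (\<phi> (inv w) y)) (\<phi> t c) \<le> \<delta>"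
      using cobA c constricting_projectionD(1)[OF \<pi>] unfolding acts_coboundedly_def by blast
    have tG: "t \<in> carrier G" and hG: "h \<in> carrier G" using t gen h HG by auto
    have Pt: "dist (P y) (\<phi> w (\<phi> t c)) \<le> \<delta>" using t w by (simp add: P_def translate_def)
    have "dist (\<phi> h y0) (\<phi> w (\<phi> t c)) \<le> dist y'' (\<phi> h y0) + dist (\<alpha> s) y'' + dist (P y) (\<alpha> s)
        + dist (P y) (\<phi> w (\<phi> t c))"
      using dist_triangle[of "\<phi> h y0" "\<phi> w (\<phi> t c)" y''] dist_triangle[of y'' "\<phi> w (\<phi> t c)" "\<alpha> s"]
        dist_triangle[of "\<alpha> s" "\<phi> w (\<phi> t c)" "P y"] by (simp add: dist_commute)
    then have "dist (\<phi> h y0) (\<phi> (w \<otimes> t) c) \<le> 2 * \<eta> + 1 + 2 * \<delta>"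
      using Pt s y'' h act_mult[OF w tG] by simp
    then have inF: "inv h \<otimes> (w \<otimes> t) \<in> F"
      using hG w tG by (simp add: F_def dist_act_left act_mult)
    have "inv h \<otimes> (w \<otimes> t) \<in> H #> (w \<otimes> t)"
      using subgroup.m_inv_closed[OF H h(1)] HG w tG by (intro rcosI) auto
    then have "H #> (w \<otimes> t) = H #> (inv h \<otimes> (w \<otimes> t))"
      using w tG by (intro repr_independence[OF _ _ H]) auto
    moreover have "dist (\<phi> w c) (P y) \<le> dist (\<phi> w c) (\<phi> w (\<phi> t c)) + dist (P y) (\<phi> w (\<phi> t c))"
      by metric
    then have "dist c (\<phi> t c) > M" using y Pt w by simp
    ultimately show ?thesis using t(1) inF by blast
  qed
  \<comment> \<open>By \<open>near\<close>, infinitely many powers of \<open>f\<close> take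
    \<open>H #> w\<close> into a finite set of cosets, so two distinct powers agree on it.\<close>
  have periodic: "\<exists>m::int. m > 0 \<and> H #> (w \<otimes> f [^] m) = H #> w" if w: "w \<in> carrier G" for w
  proof -
    define T where "T = {t \<in> generate G {f}. H #> (w \<otimes> t) \<in> (\<lambda>g. H #> g) ` F}"
    have "infinite T"
    proof
      assume "finite T"
      then obtain M where "\<And>t. t \<in> T \<Longrightarrow> dist c (\<phi> t c) \<le> M"
        using finite_imp_bounded[of "(\<lambda>t. \<phi> t c) ` T"] unfolding bounded_any_center[where a = c] by auto
      with near[OF w, of M] show False unfolding T_def by fastforce
    qed
    moreover have "finite ((\<lambda>t. H #> (w \<otimes> t)) ` T)"
      by (rule finite_subset[of _ "(\<lambda>g. H #> g) ` F"]) (auto simp: T_def finF)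
    ultimately have "\<not> inj_on (\<lambda>t. H #> (w \<otimes> t)) T" by (blast dest: finite_imageD)
    then obtain t t' where t: "t \<in> T" "t' \<in> T" "t \<noteq> t'" "H #> (w \<otimes> t) = H #> (w \<otimes> t')"
      by (auto simp: inj_on_def)
    moreover have "T \<subseteq> {f [^] k | k. k \<in> (UNIV :: int set)}"
      using generate_pow[OF f] by (auto simp: T_def)
    ultimately obtain k l :: int where kl: "t = f [^] k" "t' = f [^] l" by blast
    have shift: "H #> (w \<otimes> f [^] (j - i)) = H #> w"
      if "H #> (w \<otimes> f [^] i) = H #> (w \<otimes> f [^] j)" for i j :: int
    proof -
      have add: "(H #> (w \<otimes> f [^] i)) #> f [^] (- j) = H #> (w \<otimes> f [^] (i - j))" for i j :: int
        using coset_mult_assoc[OF HG, of "w \<otimes> f [^] i" "f [^] (- j)"] w f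
          int_pow_mult[OF f, of i "- j"] by (simp add: m_assoc)
      have "H #> (w \<otimes> f [^] (j - i)) = H #> (w \<otimes> f [^] (i - i))"
        using that add[of j i] add[of i i] by simp
      then show ?thesis using w by simp
    qed
    show ?thesis
    proof (cases "k < l")
      case True
      then show ?thesis using shift[of k l] t kl by (intro exI[of _ "l - k"]) auto
    next
      case False
      then have "l < k" using t kl by (cases "k = l") auto
      then show ?thesis using shift[of l k] t kl by (intro exI[of _ "k - l"]) auto
    qed
  qed
  \<comment> \<open>The cosets \<open>H #> x\<close> with \<open>x \<in> F\<close> have finite
    orbits under the powers of \<open>f\<close>, and by \<open>near\<close> every coset of
    \<open>H\<close> lies in one of these orbits, against infinite index.\<close>
  have "finite (\<Union>x\<in>F. (\<lambda>t. H #> (x \<otimes> t)) ` generate G {f})"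
  proof (rule finite_UN_I[OF finF])
    fix x assume "x \<in> F"
    then have x: "x \<in> carrier G" by (simp add: F_def)
    from periodic[OF x] obtain m :: int where "m > 0" "H #> (x \<otimes> f [^] m) = H #> x" by blast
    then show "finite ((\<lambda>t. H #> (x \<otimes> t)) ` generate G {f})"
      by (rule finite_coset_orbit[OF H x f])
  qed
  moreover have "rcosets H \<subseteq> (\<Union>x\<in>F. (\<lambda>t. H #> (x \<otimes> t)) ` generate G {f})"
  proof
    fix S assume "S \<in> rcosets H"
    then obtain w where w: "w \<in> carrier G" "S = H #> w" by (auto simp: RCOSETS_def)
    obtain t x where t: "t \<in> generate G {f}" "x \<in> F" "H #> (w \<otimes> t) = H #> x"
      using near[OF w(1)] by blast
    have tG: "t \<in> carrier G" "x \<in> carrier G" using t gen by (auto simp: F_def)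
    have "H #> (x \<otimes> inv t) = (H #> (w \<otimes> t)) #> inv t"
      using t coset_mult_assoc[OF HG, of x "inv t"] tG by simp
    also have "\<dots> = H #> w"
      using coset_mult_assoc[OF HG, of "w \<otimes> t" "inv t"] tG w by (simp add: m_assoc)
    finally have "S = H #> (x \<otimes> inv t)" using w by simp
    moreover have "inv t \<in> generate G {f}" using f t by (intro generate_m_inv_closed) auto
    ultimately show "S \<in> (\<Union>x\<in>F. (\<lambda>t. H #> (x \<otimes> t)) ` generate G {f})" using t by blast
  qed
  ultimately show False using index finite_subset by blast
qed

text \<open>A path from \<open>y0\<close> to \<open>z\<close> crosses near
  \<open>\<phi> h y0\<close>, since \<open>z\<close> projects far from \<open>y0\<close> on the
  translate by \<open>h\<close>. As \<open>\<phi> h y0\<close> lies in \<open>Y\<close>, the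
  crossing point projects to \<open>A\<close> near \<open>P y0\<close>, while \<open>z\<close>
  projects far away; \<open>no_backtracking\<close> then keeps the crossing point near
  \<open>y0\<close>, and properness leaves finitely many \<open>h\<close>.\<close>

lemma finitely_many_common_translates:
  assumes P: "constricting_projection \<Gamma> \<delta> A P" and H: "subgroup H G"
    and Y: "y0 \<in> Y" "invariant_set H \<phi> Y" and bdd: "bounded (P ` Y)"
  shows "\<exists>D F. finite F \<and> (\<forall>h\<in>H. \<forall>z. dist (P y0) (P z) > D \<longrightarrow>
    dist (P y0) (P (\<phi> (inv h) z)) > D \<longrightarrow> h \<in> F)"
proof -
  have \<delta>: "0 \<le> \<delta>" by (rule constricting_projection_nonneg[OF P])
  obtain D0 where D0: "\<And>y. y \<in> Y \<Longrightarrow> dist (P y0) (P y) \<le> D0"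
    using bdd unfolding bounded_any_center[where a = "P y0"] by blast
  have D0_pos: "0 \<le> D0" using D0[OF Y(1)] by simp
  \<comment> \<open>For the crossing point \<open>\<alpha> q\<close> below, \<open>c\<close> bounds
    its distance to \<open>\<phi> h y0\<close>, \<open>e\<close> the distance of its projection to
    \<open>P y0\<close>, and \<open>C\<close> its distance to \<open>y0\<close>; \<open>D\<close> is
    the threshold of \<open>no_backtracking\<close>.\<close>
  define E where "E = dist y0 (P y0)"
  define c where "c = \<delta> + D0 + E"
  define e where "e = \<mu> * c + \<nu> + 2 * \<delta> + D0"
  define C where "C = \<mu> * (\<delta> + e + E) + \<nu>"
  define D where "D = \<mu> * \<delta> + \<nu> + 4 * \<delta> + e + E + C"
  have E_pos: "0 \<le> E" by (simp add: E_def)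
  have c_pos: "0 \<le> c" using \<delta> D0_pos E_pos by (simp add: c_def)
  have e_ge: "D0 \<le> e" using nonneg \<delta> c_pos by (simp add: e_def)
  have C_pos: "0 \<le> C" using nonneg \<delta> e_ge D0_pos E_pos by (simp add: C_def)
  have "0 \<le> \<mu> * \<delta>" using nonneg \<delta> by simp
  then have D_ge: "\<delta> + D0 \<le> D" using e_ge E_pos C_pos \<delta> nonneg unfolding D_def by linarith
  define F where "F = {h \<in> carrier G. dist y0 (\<phi> h y0) \<le> C + c}"
  have "h \<in> F" if h: "h \<in> H" and z: "dist (P y0) (P z) > D" "dist (P y0) (P (\<phi> (inv h) z)) > D"
    for h z
  proof -
    have hG: "h \<in> carrier G" by (rule subgroup.mem_carrier[OF H h])
    have hY: "\<phi> h y0 \<in> Y" "\<phi> (inv h) y0 \<in> Y"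
      using Y h subgroup.m_inv_closed[OF H h] unfolding invariant_set_def by auto
    define Q where "Q = translate h P"
    have Q: "constricting_projection \<Gamma> \<delta> (\<phi> h ` A) Q"
      unfolding Q_def by (rule constricting_projection_translate[OF P hG])
    have Qy: "dist (\<phi> h (P y0)) (Q y0) \<le> D0" using D0[OF hY(2)] hG by (simp add: Q_def translate_def)
    have Qz: "dist (\<phi> h (P y0)) (Q z) > D" using z(2) hG by (simp add: Q_def translate_def)
    have "dist (\<phi> h (P y0)) (Q z) \<le> dist (\<phi> h (P y0)) (Q y0) + dist (Q y0) (Q z)" by metric
    then have Qfar: "dist (Q y0) (Q z) > \<delta>" using Qy Qz D_ge by linarith
    obtain a b \<alpha> where p: "(a, b, \<alpha>) \<in> \<Gamma>" "a \<le> b" "\<alpha> a = y0" "\<alpha> b = z"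
      by (rule joining_path)
    obtain q where q: "q \<in> {a..b}" "dist (Q y0) (\<alpha> q) \<le> \<delta>"
      using subpath_meets_balls(1)[OF Q p(1), of a b] p Qfar by auto
    have "dist (\<phi> h y0) (\<phi> h (P y0)) = E" using hG by (simp add: E_def)
    moreover have "dist (\<alpha> q) (\<phi> h y0) \<le> dist (Q y0) (\<alpha> q) + dist (\<phi> h (P y0)) (Q y0)
        + dist (\<phi> h y0) (\<phi> h (P y0))"
      by metric
    ultimately have qh: "dist (\<alpha> q) (\<phi> h y0) \<le> c" using q Qy by (simp add: c_def)
    have "dist (P (\<alpha> q)) (P (\<phi> h y0)) \<le> \<mu> * dist (\<alpha> q) (\<phi> h y0) + \<nu> + 2 * \<delta>"
      by (rule projection_coarse_lipschitz[OF P])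
    moreover have "\<mu> * dist (\<alpha> q) (\<phi> h y0) \<le> \<mu> * c" using qh nonneg by (intro mult_left_mono)
    moreover have "dist (P (\<alpha> q)) (P y0) \<le> dist (P (\<alpha> q)) (P (\<phi> h y0)) + dist (P y0) (P (\<phi> h y0))"
      by metric
    ultimately have "dist (P (\<alpha> q)) (P y0) \<le> e" using D0[OF hY(1)] unfolding e_def by linarith
    then have "dist (\<alpha> a) (\<alpha> q) \<le> C"
      unfolding C_def
      using z(1) p by (intro no_backtracking[OF P p(1) q(1)]) (simp_all add: E_def D_def C_def)
    moreover have "dist y0 (\<phi> h y0) \<le> dist y0 (\<alpha> q) + dist (\<alpha> q) (\<phi> h y0)" by metric
    ultimately show ?thesis using qh p hG by (simp add: F_def)
  qed
  moreover have "finite F" unfolding F_def by (rule finite_orbit_near)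
  ultimately show ?thesis by blast
qed

section \<open>Powers of the constricting element and comparison of balls with cosets\<close>

lemma exists_power_moving_far:
  assumes f: "f \<in> carrier G" and order: "\<And>n::nat. n > 0 \<Longrightarrow> f [^] n \<noteq> \<one>"
  shows "\<exists>t\<in>generate G {f}. dist x (\<phi> t x) > r"
proof (rule ccontr)
  assume "\<not> ?thesis"
  then have le: "dist x (\<phi> t x) \<le> r" if "t \<in> generate G {f}" for t
    using that by fastforce
  \<comment> \<open>Infinite order gives infinitely many distinct powers, while properness admits
    only finitely many elements moving \<open>x\<close> by at most \<open>r\<close>.\<close>
  have "inj (\<lambda>n::nat. f [^] n)"
  proof (rule injI)
    fix m n :: nat assume eq: "f [^] m = f [^] n"
    \<comment> \<open>Subtraction is truncated: for \<open>m \<noteq> n\<close> exactly one of the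
      two differences is positive.\<close>
    then have "f [^] (m - n) = \<one>" "f [^] (n - m) = \<one>"
      using pow_eq_div2[OF f eq] pow_eq_div2[OF f eq[symmetric]] by auto
    then show "m = n" using order[of "m - n"] order[of "n - m"] by force
  qed
  moreover have "range (\<lambda>n::nat. f [^] n) \<subseteq> {g \<in> carrier G. dist x (\<phi> g x) \<le> r}"
  proof clarify
    fix n :: nat
    have "f [^] n \<in> generate G {f}" unfolding generate_pow[OF f] int_pow_int[symmetric] by blast
    then show "f [^] n \<in> carrier G \<and> dist x (\<phi> (f [^] n) x) \<le> r" using le f by auto
  qed
  ultimately show False
    using finite_orbit_near finite_subset range_inj_infinite by blast
qed

text \<open>The two inclusions make \<open>t\<close> preserve \<open>A\<close>, so conjugating \<pi>
  by \<open>t\<close> gives another constricting projection onto \<open>A\<close>, and coarse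
  uniqueness compares the two.\<close>

lemma projection_coarsely_equivariant:
  assumes \<pi>: "constricting_projection \<Gamma> \<delta> A \<pi>"
    and t: "t \<in> carrier G" "\<phi> t ` A \<subseteq> A" "\<phi> (inv t) ` A \<subseteq> A"
  shows "dist (\<phi> t (\<pi> x)) (\<pi> (\<phi> t x)) \<le> \<mu> * \<delta> + \<nu> + 4 * \<delta>"
proof -
  have "\<phi> (inv t) ` A = A"
  proof
    show "A \<subseteq> \<phi> (inv t) ` A"
    proof
      fix z assume "z \<in> A"
      then have "\<phi> t z \<in> A" "z = \<phi> (inv t) (\<phi> t z)" using t by auto
      then show "z \<in> \<phi> (inv t) ` A" by blast
    qed
  qed (rule t(3))
  then have "constricting_projection \<Gamma> \<delta> A (translate (inv t) \<pi>)"
    using constricting_projection_translate[OF \<pi>, of "inv t"] t by simp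
  from projection_coarsely_unique[OF \<pi> this, of x]
  have "dist (\<pi> x) (\<phi> (inv t) (\<pi> (\<phi> t x))) \<le> \<mu> * \<delta> + \<nu> + 4 * \<delta>"
    using t by (simp add: translate_def)
  then show ?thesis using t by (simp add: dist_act_left)
qed

lemma ball_le_right_cosets:
  assumes f: "constricting_element G \<phi> \<Gamma> f" and H: "quasi_convex_subgroup G \<phi> \<Gamma> H"
    and index: "infinite (rcosets H)"
  shows "\<exists>K c. 0 < K \<and> 0 \<le> c \<and> (\<forall>r. real (card (gball G \<phi> x0 r)) \<le>
    K * real (card ((\<lambda>g. H #> g) ` gball G \<phi> x0 (r + c))))"
proof -
  have fG: "f \<in> carrier G" and order: "\<And>n::nat. n > 0 \<Longrightarrow> f [^] n \<noteq> \<one>"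
    using f by (auto simp: constricting_element_def)
  obtain \<delta> A \<pi> where invA: "invariant_set (generate G {f}) \<phi> A"
    and \<pi>: "constricting_projection \<Gamma> \<delta> A \<pi>" and cobA: "acts_coboundedly (generate G {f}) \<phi> A \<delta>"
    using f by (auto simp: constricting_element_def constricting_set_iff_projection)
  obtain \<eta> Y where HS: "subgroup H G" and Y: "Y \<noteq> {}" "invariant_set H \<phi> Y"
    "quasi_convex_set \<Gamma> \<eta> Y" "acts_coboundedly H \<phi> Y \<eta>"
    using H by (auto simp: quasi_convex_subgroup_def)
  obtain w where w: "w \<in> carrier G" "bounded (translate w \<pi> ` Y)"
    using exists_bounded_projection[OF \<pi> fG cobA HS Y(1,3,4) index] by blast
  obtain y0 where y0: "y0 \<in> Y" using Y by blast
  define P where "P = translate w \<pi>"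
  have P: "constricting_projection \<Gamma> \<delta> (\<phi> w ` A) P"
    unfolding P_def by (rule constricting_projection_translate[OF \<pi> w(1)])
  obtain D F where F: "finite F"
    and DF: "\<And>h z. h \<in> H \<Longrightarrow> dist (P y0) (P z) > D \<Longrightarrow> dist (P y0) (P (\<phi> (inv h) z)) > D \<Longrightarrow> h \<in> F"
    using finitely_many_common_translates[OF P HS y0 Y(2) w(2)[folded P_def]] by blast
  define c where "c = \<pi> (\<phi> (inv w) y0)"
  define L where "L = \<mu> * \<delta> + \<nu> + 4 * \<delta>"
  \<comment> \<open>With this choice the projections of \<open>\<phi> g x0\<close> and of its
    translate by \<open>t\<close> cannot both be within \<open>D\<close> of \<open>c\<close>: the
    second is within \<open>L\<close> of the image under \<open>t\<close> of the first.\<close>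
  obtain t where t: "t \<in> generate G {f}" "dist c (\<phi> t c) > 2 * D + L"
    using exists_power_moving_far[OF fG order] by blast
  have tG: "t \<in> carrier G" using t generate_incl[of "{f}"] fG by auto
  have "inv t \<in> generate G {f}" using fG t by (intro generate_m_inv_closed) auto
  then have tA: "\<phi> t ` A \<subseteq> A" "\<phi> (inv t) ` A \<subseteq> A"
    using invA t by (auto simp: invariant_set_def)
  define B where "B r = gball G \<phi> x0 r" for r
  define cosets where "cosets r = (\<lambda>g. H #> g) ` B r" for r
  define far where "far u = {g. dist (P y0) (P (\<phi> (u \<otimes> g) x0)) > D}" for u
  \<comment> \<open>A common bound for the displacement of \<open>x0\<close> by the two multipliers
    \<open>w\<close> and \<open>w \<otimes> t\<close>.\<close>
  define s where "s = dist x0 (\<phi> w x0) + dist x0 (\<phi> (w \<otimes> t) x0)"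
  have finB: "finite (B r)" and BG: "B r \<subseteq> carrier G" for r
    using proper by (auto simp: B_def proper_action_def gball_def)
  have P_w: "dist (P y0) (P (\<phi> w x)) = dist c (\<pi> x)" for x
    using w by (simp add: P_def translate_def c_def)
  have cover: "g \<in> far w \<union> far (w \<otimes> t)" if g: "g \<in> carrier G" for g
  proof (rule ccontr)
    assume "g \<notin> far w \<union> far (w \<otimes> t)"
    then have "dist c (\<pi> (\<phi> g x0)) \<le> D" "dist c (\<pi> (\<phi> t (\<phi> g x0))) \<le> D"
      using g w tG by (auto simp: far_def act_mult P_w)
    moreover have "dist (\<phi> t (\<pi> (\<phi> g x0))) (\<pi> (\<phi> t (\<phi> g x0))) \<le> L"
      unfolding L_def by (rule projection_coarsely_equivariant[OF \<pi> tG tA])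
    moreover have "dist (\<phi> t c) (\<phi> t (\<pi> (\<phi> g x0))) = dist c (\<pi> (\<phi> g x0))" using tG by simp
    moreover have "dist c (\<phi> t c) \<le> dist c (\<pi> (\<phi> t (\<phi> g x0)))
        + dist (\<phi> t (\<pi> (\<phi> g x0))) (\<pi> (\<phi> t (\<phi> g x0))) + dist (\<phi> t c) (\<phi> t (\<pi> (\<phi> g x0)))"
      by metric
    ultimately show False using t(2) by linarith
  qed
  have fibre: "card (B r \<inter> far u) \<le> card F * card (cosets (r + s))"
    if u: "u \<in> carrier G" "dist x0 (\<phi> u x0) \<le> s" for u r
  proof (rule card_le_of_coset_fibres[OF HS u(1)])
    show "B r \<inter> far u \<subseteq> carrier G" using BG by blast
    show "finite F" by (rule F)
    show "finite (cosets (r + s))" using finB by (simp add: cosets_def)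
    show "H #> (u \<otimes> g) \<in> cosets (r + s)" if "g \<in> B r \<inter> far u" for g
    proof -
      have g: "g \<in> carrier G" "dist x0 (\<phi> g x0) \<le> r" using that by (auto simp: B_def gball_def)
      have "dist x0 (\<phi> (u \<otimes> g) x0) \<le> dist x0 (\<phi> u x0) + dist (\<phi> u x0) (\<phi> (u \<otimes> g) x0)" by metric
      also have "dist (\<phi> u x0) (\<phi> (u \<otimes> g) x0) = dist x0 (\<phi> g x0)" using u g by (simp add: act_mult)
      finally have "u \<otimes> g \<in> B (r + s)" using u g by (simp add: B_def gball_def)
      then show ?thesis by (auto simp: cosets_def)
    qed
    \<comment> \<open>With \<open>\<phi> (u \<otimes> g) x0\<close> as \<open>z\<close>, the element
      \<open>inv h\<close> moves \<open>z\<close> to \<open>\<phi> (u \<otimes> g') x0\<close>; both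
      points project far, as \<open>DF\<close> demands.\<close>
    show "h \<in> F" if g: "g \<in> B r \<inter> far u" "g' \<in> B r \<inter> far u" and h: "h \<in> H"
      and eq: "u \<otimes> g = h \<otimes> (u \<otimes> g')" for g g' h
    proof (rule DF[OF h])
      have G: "g \<in> carrier G" "g' \<in> carrier G" "h \<in> carrier G"
        using g BG subgroup.mem_carrier[OF HS h] by auto
      show "dist (P y0) (P (\<phi> (u \<otimes> g) x0)) > D" using g by (simp add: far_def)
      have "\<phi> (inv h) (\<phi> (u \<otimes> g) x0) = \<phi> (u \<otimes> g') x0" using G u by (simp add: eq act_mult[of h])
      then show "dist (P y0) (P (\<phi> (inv h) (\<phi> (u \<otimes> g) x0))) > D" using g by (simp add: far_def)
    qed
  qed
  \<comment> \<open>The two far sets cover the ball, which gives the factor \<open>2\<close>; the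
    added \<open>1\<close> keeps the constant positive even if \<open>F\<close> is empty.\<close>
  have "real (card (B r)) \<le> (2 * real (card F) + 1) * real (card (cosets (r + s)))" for r
  proof -
    have "B r = (B r \<inter> far w) \<union> (B r \<inter> far (w \<otimes> t))" using cover BG by blast
    then have "card (B r) \<le> card (B r \<inter> far w) + card (B r \<inter> far (w \<otimes> t))"
      by (metis card_Un_le)
    also have "\<dots> \<le> 2 * (card F * card (cosets (r + s)))"
      using fibre[of w r] fibre[of "w \<otimes> t" r] w tG by (simp add: s_def)
    also have "\<dots> \<le> (2 * card F + 1) * card (cosets (r + s))" by (simp add: algebra_simps)
    finally have "real (card (B r)) \<le> real ((2 * card F + 1) * card (cosets (r + s)))"
      by (rule of_nat_mono)
    then show ?thesis by (simp add: algebra_simps)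
  qed
  moreover have "0 < 2 * real (card F) + 1" "0 \<le> s" by (auto simp: s_def add_nonneg_nonneg)
  ultimately show ?thesis unfolding cosets_def B_def by blast
qed

end

section \<open>Equality of the three growth rates\<close>

lemma path_system_abs:
  assumes "path_system \<mu> \<nu> \<Gamma>"
  shows "path_system \<bar>\<mu>\<bar> \<bar>\<nu>\<bar> \<Gamma>"
proof -
  \<comment> \<open>Larger constants only weaken the quasi-geodesic inequality; the absolute values
    provide the signs that \<open>path_space\<close> assumes.\<close>
  have "quasi_geodesic \<bar>\<mu>\<bar> \<bar>\<nu>\<bar> (a, b, \<alpha>)" if "quasi_geodesic \<mu> \<nu> (a, b, \<alpha>)"
    for a b and \<alpha> :: "real \<Rightarrow> 'a"
  proof -
    have "\<mu> * dist x y + \<nu> \<le> \<bar>\<mu>\<bar> * dist x y + \<bar>\<nu>\<bar>" for x y :: 'a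
      by (intro add_mono mult_right_mono) auto
    with that show ?thesis unfolding quasi_geodesic_def prod.case by (meson order_trans)
  qed
  then show ?thesis using assms unfolding path_system_def by (metis prod_cases3)
qed

theorem mainTheorem3:
  fixes G :: "('g, 'b) monoid_scheme"
    and \<phi> :: "'g \<Rightarrow> 'x::metric_space \<Rightarrow> 'x"
    and \<Gamma> :: "'x path set"
    and \<mu> \<nu> :: real
    and H :: "'g set"
    and x0 :: 'x
  assumes "path_system_group G \<phi> \<Gamma> \<mu> \<nu>"
    and "\<exists>g. constricting_element G \<phi> \<Gamma> g"
    and "quasi_convex_subgroup G \<phi> \<Gamma> H"
    and "infinite (rcosets\<^bsub>G\<^esub> H)"
  shows "omega_left G \<phi> H x0 = omega_G G \<phi> x0 \<and> omega_right G \<phi> H x0 = omega_G G \<phi> x0"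
proof -
  have psg: "isometric_action G \<phi>" "proper_action G \<phi>" "path_system \<mu> \<nu> \<Gamma>"
    "\<And>g a b \<alpha>. g \<in> carrier G \<Longrightarrow> (a, b, \<alpha>) \<in> \<Gamma> \<Longrightarrow> (a, b, \<phi> g \<circ> \<alpha>) \<in> \<Gamma>"
    using assms(1) by (auto simp: path_system_group_def)
  interpret group G using psg(1) by (simp add: isometric_action_def)
  interpret path_group G \<Gamma> "\<bar>\<mu>\<bar>" "\<bar>\<nu>\<bar>" \<phi>
    by unfold_locales (use psg path_system_abs in auto)
  have H: "subgroup H G" using assms(3) by (simp add: quasi_convex_subgroup_def)
  have finB: "finite (gball G \<phi> x0 r)" for r using proper by (simp add: proper_action_def)
  have oneB: "\<one>\<^bsub>G\<^esub> \<in> gball G \<phi> x0 r" if "0 \<le> r" for r using that by (simp add: gball_def)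
  define M where "M r = card (gball G \<phi> x0 r)" for r
  define N where "N r = card ((\<lambda>g. r_coset G H g) ` gball G \<phi> x0 r)" for r
  \<comment> \<open>The identity lies in every ball of radius at least \<open>0\<close>, so
    logarithms are taken of positive numbers.\<close>
  have pos: "0 < M r" "0 < N r" if "0 \<le> r" for r
    using oneB[OF that] finB by (auto simp: M_def N_def card_gt_0_iff)
  have "N r \<le> M r" for r unfolding M_def N_def by (rule card_image_le[OF finB])
  then have "growth_rate N \<le> growth_rate M" by (intro growth_rate_mono pos)
  moreover obtain f where "constricting_element G \<phi> \<Gamma> f" using assms(2) by blast
  then obtain K c where "0 < K" "0 \<le> c" "\<And>r. real (M r) \<le> K * real (N (r + c))"
    using ball_le_right_cosets[of f H x0] assms(3,4) unfolding M_def N_def by blast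
  then have "growth_rate M \<le> growth_rate N" by (intro growth_rate_le_of_shift[of M N K c] pos)
  ultimately have right: "omega_right G \<phi> H x0 = omega_G G \<phi> x0"
    unfolding omega_right_def omega_G_def M_def N_def by (rule antisym)
  \<comment> \<open>The inverse of \<open>g\<close> moves \<open>x0\<close> exactly as far as
    \<open>g\<close> does, so balls are closed under inversion.\<close>
  have "card ((\<lambda>g. l_coset G g H) ` gball G \<phi> x0 r) = card ((\<lambda>g. r_coset G H g) ` gball G \<phi> x0 r)" for r
  proof (rule card_left_cosets_eq_right_cosets[OF H])
    show "gball G \<phi> x0 r \<subseteq> carrier G" by (auto simp: gball_def)
    show "inv\<^bsub>G\<^esub> g \<in> gball G \<phi> x0 r" if "g \<in> gball G \<phi> x0 r" for g
      using that dist_act_left[of g x0 x0] by (simp add: gball_def dist_commute)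
  qed
  then have "omega_left G \<phi> H x0 = omega_right G \<phi> H x0"
    unfolding omega_left_def omega_right_def by presburger
  with right show ?thesis by simp
qed

end
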